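(* Let $n\ge 3$. For $Y=(y_{i,j})\in\mathbb R^{C}$, $i\in[n]$ and $j\in[n-1]$ write $$L_{i,j}(Y)=\sum_{i'=1}^{\min\{i,j\}}y_{i',i}+\sum_{j'=i+1}^{j}y_{i,j'}.$$ The facets of $P^{\mathrm{core}}_{\mathrm{DSASM}}$ are exactly the following faces of $P^{\mathrm{core}}_{\mathrm{DSASM}}$, one for each listed equation: (a) $\{L_{i,j}(Y)=0\}$ for $(i,j)\in([2,n-1]\times[2,n-2])\cup([n]\times\{1\})$; (b) $\{L_{i,j}(Y)=1\}$ for $(i,j)\in([2,n-1]\times[2,n-2])\cup([2,n]\times\{n-1\})$. In particular, the number of facets of $P^{\mathrm{core}}_{\mathrm{DSASM}}$ is $2(n-2)^2+3$.
   Context: $[a,b]=\{a,a+1,\dots,b\}$ for integers $a\le b$, $[a,b]=\emptyset$ if $a>b$, and $[n]=[1,n]$; empty sums are $0$. An $n\times n$ alternating sign matrix (ASM) is an $n\times n$ matrix with entries in $\{0,1,-1\}$ such that in each row and each column the non-zero entries alternate in sign and the first and last non-zero entries are $1$ (so every row and column sums to $1$). A DSASM is an $n\times n$ ASM $X$ with $x_{i,j}=x_{j,i}$ for all $i,j\in[n]$. The set of core positions is $C=\{(i,j)\in[n]\times[n]: i\le j\}$. The core of a DSASM $X$ is $(x_{i,j})_{(i,j)\in C}\in\mathbb R^C$, and $P^{\mathrm{core}}_{\mathrm{DSASM}}\subseteq\mathbb R^{C}$ is the convex hull of the cores of all $n\times n$ DSASMs. A facet of a polytope $P$ is a face of dimension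 $\dim P-1$; by "the face $\{L(Y)=c\}$" we mean $\{Y\in P^{\mathrm{core}}_{\mathrm{DSASM}}: L(Y)=c\}$. *)

theory Defs
  imports "HOL-Analysis.Analysis"
begin

text \<open>
  Matrices of size \<open>n\<close> are functions \<open>nat \<Rightarrow> nat \<Rightarrow> real\<close>, read only at indices in \<open>{1..n}\<close>;
  values at other indices are irrelevant.
\<close>

definition alternating_line :: "real list \<Rightarrow> bool" where
  "alternating_line xs \<longleftrightarrow>
     (let ys = filter (\<lambda>x. x \<noteq> 0) xs in
        ys \<noteq> [] \<and> hd ys = 1 \<and> last ys = 1 \<and> successively (\<lambda>x y. sgn y = - sgn x) ys)"

definition is_ASM :: "nat \<Rightarrow> (nat \<Rightarrow> nat \<Rightarrow> real) \<Rightarrow> bool" where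
  "is_ASM n X \<longleftrightarrow>
     (\<forall>i\<in>{1..n}. \<forall>j\<in>{1..n}. X i j \<in> {0, 1, -1}) \<and>
     (\<forall>i\<in>{1..n}. alternating_line (map (\<lambda>j. X i j) [1..<Suc n])) \<and>
     (\<forall>j\<in>{1..n}. alternating_line (map (\<lambda>i. X i j) [1..<Suc n]))"

definition is_DSASM :: "nat \<Rightarrow> (nat \<Rightarrow> nat \<Rightarrow> real) \<Rightarrow> bool" where
  "is_DSASM n X \<longleftrightarrow> is_ASM n X \<and> (\<forall>i\<in>{1..n}. \<forall>j\<in>{1..n}. X i j = X j i)"

text \<open>
  The set \<open>C\<close> of core positions, as a type depending on \<open>n = CARD('n)\<close>, so that the space
  of real families indexed by \<open>C\<close> is the Euclidean space \<open>real ^ 'n core_pos\<close>.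
  Only the cardinality of \<open>'n\<close> matters.
\<close>

typedef ('n::finite) core_pos = "{(i :: nat, j :: nat). 1 \<le> i \<and> i \<le> j \<and> j \<le> CARD('n::finite)}"
proof
  show "(1, 1) \<in> {(i, j). 1 \<le> i \<and> i \<le> j \<and> j \<le> CARD('n)}"
    by (simp add: Suc_le_eq)
qed

instance core_pos :: (finite) finite
proof
  have "{(i, j). 1 \<le> i \<and> i \<le> j \<and> j \<le> CARD('a)} \<subseteq> {1..CARD('a)} \<times> {1..CARD('a)}"
    by auto
  then have "finite {(i, j). 1 \<le> i \<and> i \<le> j \<and> j \<le> CARD('a)}"
    by (rule finite_subset) simp
  then show "finite (UNIV :: 'a core_pos set)"
    unfolding type_definition.univ[OF type_definition_core_pos] by (rule finite_imageI)
qed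

text \<open>\<open>entry Y i j\<close> is meaningful only for \<open>1 \<le> i \<le> j \<le> CARD('n)\<close>.\<close>

definition entry :: "real ^ ('n::finite) core_pos \<Rightarrow> nat \<Rightarrow> nat \<Rightarrow> real" where
  "entry Y i j = Y $ Abs_core_pos (i, j)"

definition core :: "(nat \<Rightarrow> nat \<Rightarrow> real) \<Rightarrow> real ^ ('n::finite) core_pos" where
  "core X = (\<chi> p. case Rep_core_pos p of (i, j) \<Rightarrow> X i j)"

definition P_core_DSASM :: "(real ^ ('n::finite) core_pos) set" where
  "P_core_DSASM = convex hull (core ` {X. is_DSASM CARD('n) X})"

definition L :: "nat \<Rightarrow> nat \<Rightarrow> real ^ ('n::finite) core_pos \<Rightarrow> real" where
  "L i j Y = (\<Sum>i'=1..min i j. entry Y i' i) + (\<Sum>j'=i+1..j. entry Y i j')"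

end

theory Submission
  imports Defs
begin

text \<open>
  In terms of the corner sums \<open>h\<close> of the full symmetric matrix, \<open>L i j = h i j - h (i - 1) j\<close>, so
  the inequalities \<open>0 \<le> L i j \<le> 1\<close> with \<open>L i n = 1\<close> form a system of difference constraints with
  integer bounds. Its extreme points are integral, hence cores of DSASMs, and by Krein--Milman the
  system describes the polytope. The inequalities that are not listed follow from the listed
  ones because the first and last rows have non-negative entries. No listed inequality is
  redundant: for each there is an integral \<open>h\<close> violating it alone. Since the point
  \<open>h i j = i * j / n\<close> satisfies all of them strictly, the listed inequalities correspond
  bijectively to the facets.
\<close>

subsection \<open>Facets of irredundant systems\<close>

lemma facets_of_irredundant_system:
  fixes P A :: "'a::euclidean_space set" and f :: "'k \<Rightarrow> 'a \<Rightarrow> real"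
  assumes K: "finite K" and lin: "\<And>k. k \<in> K \<Longrightarrow> linear (f k)" and A: "affine A"
    and P: "P = {x \<in> A. \<forall>k\<in>K. f k x \<le> b k}"
    and z: "z \<in> A" "\<And>k. k \<in> K \<Longrightarrow> f k z < b k"
    and irred: "\<And>k. k \<in> K \<Longrightarrow> \<exists>x\<in>A. f k x > b k \<and> (\<forall>k'\<in>K - {k}. f k' x \<le> b k')"
  shows "bij_betw (\<lambda>k. {x \<in> P. f k x = b k}) K {F. F facet_of P}"
proof -
  have cont: "continuous_on UNIV (f k)" if "k \<in> K" for k
    using lin[OF that] by (simp add: linear_continuous_on linear_conv_bounded_linear)
  define U where "U = (\<Inter>k\<in>K. {x. f k x < b k})"
  have "open U"
    unfolding U_def using K cont by (intro open_INT ballI open_Collect_less) auto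
  moreover have "A \<inter> U \<noteq> {}"
    using z by (auto simp: U_def)
  ultimately have "affine hull (A \<inter> U) = A"
    using affine_hull_affine_Int_open[OF A] by (simp add: hull_same A)
  moreover have "A \<inter> U \<subseteq> P" "P \<subseteq> A"
    by (auto simp: P U_def less_imp_le)
  ultimately have hull: "affine hull P = A"
    by (metis A hull_minimal hull_mono subset_antisym)
  define a where "a k = adjoint (f k) 1" for k
  have a: "a k \<bullet> x = f k x" if "k \<in> K" for k x
    using adjoint_works[OF lin[OF that], of x 1] by (simp add: a_def inner_commute)
  define H where "H k = {x. a k \<bullet> x \<le> b k}" for k
  obtain w where w: "\<And>k. k \<in> K \<Longrightarrow> w k \<in> A \<and> f k (w k) > b k \<and> (\<forall>k'\<in>K - {k}. f k' (w k) \<le> b k')"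
    using irred by metis
  have wH: "w k \<in> H k' \<longleftrightarrow> k \<noteq> k'" if "k \<in> K" "k' \<in> K" for k k'
    using w[OF that(1)] that by (auto simp: H_def a)
  have injH: "inj_on H K"
    by (rule inj_onI) (metis wH)
  \<comment> \<open>\<open>facet_of_polyhedron_explicit\<close> indexes the constraints by the
    halfspaces themselves. The violators separate the halfspaces, so the index can be recovered from
    \<open>H k\<close>.\<close>
  define r where "r = the_inv_into K H"
  have r: "r (H k) = k" if "k \<in> K" for k
    using the_inv_into_f_f[OF injH that] by (simp add: r_def)
  have PH: "P = affine hull P \<inter> \<Inter>(H ` K)"
    unfolding hull unfolding P by (auto simp: H_def a)
  have nz: "a k \<noteq> 0" if "k \<in> K" for k
    using w[OF that] z(2)[OF that] a[OF that, of "w k"] a[OF that, of z] by auto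
  have facet: "F facet_of P \<longleftrightarrow> (\<exists>h. h \<in> H ` K \<and> F = P \<inter> {x. a (r h) \<bullet> x = b (r h)})" for F
  proof (rule facet_of_polyhedron_explicit[OF _ PH])
    show "finite (H ` K)"
      using K by simp
    show "a (r h) \<noteq> 0 \<and> h = {x. a (r h) \<bullet> x \<le> b (r h)}" if "h \<in> H ` K" for h
      using that r nz by (auto simp: H_def)
    show "P \<subset> affine hull P \<inter> \<Inter>F'" if F': "F' \<subset> H ` K" for F'
    proof -
      from F' obtain k where k: "k \<in> K" "H k \<notin> F'"
        by blast
      have "w k \<in> \<Inter>F'"
      proof
        fix h assume "h \<in> F'"
        then obtain k' where "k' \<in> K" "h = H k'" "k' \<noteq> k"
          using F' k by blast
        then show "w k \<in> h"
          using wH[OF k(1)] by blast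
      qed
      moreover have "w k \<notin> P"
        using wH[OF k(1) k(1)] k(1) PH by blast
      moreover have "w k \<in> affine hull P"
        using w[OF k(1)] unfolding hull by blast
      moreover have "P \<subseteq> affine hull P \<inter> \<Inter>F'"
        using F' by (subst PH) blast
      ultimately show ?thesis
        by blast
    qed
  qed
  have facets: "{F. F facet_of P} = (\<lambda>k. {x \<in> P. f k x = b k}) ` K"
    unfolding facet using a r by (auto simp: image_iff)
  have inj: "inj_on (\<lambda>k. {x \<in> P. f k x = b k}) K"
  proof (rule inj_onI, rule ccontr)
    fix k k' assume k: "k \<in> K" "k' \<in> K" "{x \<in> P. f k x = b k} = {x \<in> P. f k' x = b k'}" "k \<noteq> k'"
    \<comment> \<open>The parameter at which the segment from \<open>z\<close> to \<open>w k\<close>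
      meets the hyperplane of \<open>k\<close>. There every other constraint is still strict, being
      strict at \<open>z\<close> and valid at \<open>w k\<close>.\<close>
    define t where "t = (b k - f k z) / (f k (w k) - f k z)"
    define x where "x = (1 - t) *\<^sub>R z + t *\<^sub>R w k"
    have lt: "f k z < b k" "b k < f k (w k)"
      using z w k by auto
    then have t: "0 < t" "t < 1"
      by (auto simp: t_def)
    have fx: "f m x = (1 - t) * f m z + t * f m (w k)" if "m \<in> K" for m
      using lin[OF that] by (simp add: x_def linear_add linear_scale)
    have "f k x = f k z + t * (f k (w k) - f k z)"
      using fx[OF k(1)] by (simp add: algebra_simps)
    then have eq: "f k x = b k"
      using lt by (simp add: t_def)
    have less: "f m x < b m" if "m \<in> K" "m \<noteq> k" for m
    proof -
      have "(1 - t) * f m z < (1 - t) * b m" "t * f m (w k) \<le> t * b m"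
        using t z(2)[OF that(1)] w[OF k(1)] that by auto
      then show ?thesis
        unfolding fx[OF that(1)] by (simp add: algebra_simps)
    qed
    have "x \<in> A"
      using A z(1) w[OF k(1)] by (simp add: x_def affine_alt)
    then have "x \<in> P"
      using eq less unfolding P by force
    then show False
      using k eq less[of k'] by force
  qed
  show ?thesis
    using inj facets by (simp add: bij_betw_def)
qed

subsection \<open>Integrality of the polytope of partial row sums\<close>

lemma successively_snoc_iff:
  "successively R (xs @ [x]) \<longleftrightarrow> successively R xs \<and> (xs \<noteq> [] \<longrightarrow> R (last xs) x)"
  by (auto simp: successively_append_iff)

text \<open>The hypothesis omits the condition on the last non-zero entry so that it passes to
  prefixes, as induction from the right requires. The sum is then read off from that entry.\<close>

lemma alternating_line_imp_prefix_sums: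
  fixes xs :: "real list"
  assumes "set xs \<subseteq> {0, 1, -1}"
    and "let ys = filter (\<lambda>x. x \<noteq> 0) xs in (ys \<noteq> [] \<longrightarrow> hd ys = 1) \<and> successively (\<lambda>x y. sgn y = - sgn x) ys"
  shows "(\<forall>k\<le>length xs. sum_list (take k xs) \<in> {0, 1}) \<and>
    sum_list xs = (let ys = filter (\<lambda>x. x \<noteq> 0) xs in if ys = [] \<or> last ys \<noteq> 1 then 0 else 1)"
  using assms
proof (induction xs rule: rev_induct)
  case (snoc x xs)
  define ys where "ys = filter (\<lambda>x. x \<noteq> 0) xs"
  have last: "last ys \<in> {1, -1}" if "ys \<noteq> []"
    using last_in_set[OF that] snoc.prems(1) by (auto simp: ys_def)
  have IH: "\<forall>k\<le>length xs. sum_list (take k xs) \<in> {0, 1}"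
    "sum_list xs = (if ys = [] \<or> last ys \<noteq> 1 then 0 else 1)"
    using snoc by (auto simp: successively_snoc_iff hd_append Let_def ys_def split: if_splits)
  have total: "sum_list (xs @ [x]) = (let zs = filter (\<lambda>x. x \<noteq> 0) (xs @ [x]) in if zs = [] \<or> last zs \<noteq> 1 then 0 else 1)"
    using snoc.prems IH(2) last
    by (auto simp: successively_snoc_iff hd_append Let_def simp flip: ys_def split: if_splits)
  then have "sum_list (xs @ [x]) \<in> {0, 1}"
    by (simp add: Let_def)
  then have "\<forall>k\<le>length (xs @ [x]). sum_list (take k (xs @ [x])) \<in> {0, 1}"
    using IH(1) by (auto simp: le_Suc_eq)
  with total show ?case by blast
qed simp

text \<open>Each entry is a difference of consecutive prefix sums, so a non-zero entry switches the
  sum between 0 and 1. The last non-zero entry is therefore 1 or -1 as the total is 1 or 0, which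
  \<open>2 * sum_list xs - 1\<close> expresses.\<close>

lemma prefix_sums_imp_alternating:
  fixes xs :: "real list"
  assumes "\<forall>k\<le>length xs. sum_list (take k xs) \<in> {0, 1}"
  shows "set xs \<subseteq> {0, 1, -1} \<and>
    (let ys = filter (\<lambda>x. x \<noteq> 0) xs in (ys \<noteq> [] \<longrightarrow> hd ys = 1 \<and> last ys = 2 * sum_list xs - 1) \<and>
      (ys = [] \<longrightarrow> sum_list xs = 0) \<and> successively (\<lambda>x y. sgn y = - sgn x) ys)"
  using assms
proof (induction xs rule: rev_induct)
  case (snoc x xs)
  define ys where "ys = filter (\<lambda>x. x \<noteq> 0) xs"
  have "\<forall>k\<le>length xs. sum_list (take k xs) \<in> {0, 1}"
    using snoc.prems by (auto dest: le_SucI)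
  then have sums: "sum_list xs \<in> {0, 1}" and IH: "set xs \<subseteq> {0, 1, -1}"
    "ys \<noteq> [] \<Longrightarrow> hd ys = 1 \<and> last ys = 2 * sum_list xs - 1"
    "ys = [] \<Longrightarrow> sum_list xs = 0" "successively (\<lambda>x y. sgn y = - sgn x) ys"
    using snoc.IH by (auto simp: Let_def ys_def)
  moreover have "sum_list xs + x \<in> {0, 1}"
    using snoc.prems[rule_format, of "length (xs @ [x])"] by simp
  ultimately show ?case
    by (auto simp: successively_snoc_iff hd_append Let_def simp flip: ys_def)
qed simp

lemma alternating_line_iff_prefix_sums:
  "set xs \<subseteq> {0, 1, -1} \<and> alternating_line xs \<longleftrightarrow>
    (\<forall>k\<le>length xs. sum_list (take k xs) \<in> {0, 1}) \<and> sum_list xs = 1"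
  using alternating_line_imp_prefix_sums[of xs] prefix_sums_imp_alternating[of xs]
  by (auto simp: alternating_line_def Let_def split: if_splits)

text \<open>By symmetry the column conditions repeat the row conditions, so only prefix sums of rows
  remain.\<close>

lemma is_DSASM_iff_prefix_sums:
  "is_DSASM n X \<longleftrightarrow> (\<forall>i\<in>{1..n}. \<forall>j\<in>{1..n}. X i j = X j i) \<and>
    (\<forall>i\<in>{1..n}. (\<forall>j\<le>n. (\<Sum>k=1..j. X i k) \<in> {0, 1}) \<and> (\<Sum>k=1..n. X i k) = 1)"
proof (cases "\<forall>i\<in>{1..n}. \<forall>j\<in>{1..n}. X i j = X j i")
  case True
  have col: "alternating_line (map (\<lambda>i. X i j) [1..<Suc n]) \<longleftrightarrow> alternating_line (map (X j) [1..<Suc n])"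
    if "j \<in> {1..n}" for j
  proof -
    have "map (\<lambda>i. X i j) [1..<Suc n] = map (X j) [1..<Suc n]"
      using True that by auto
    then show ?thesis
      by (simp only:)
  qed
  have take: "sum_list (take j (map (X i) [1..<Suc n])) = (\<Sum>k=1..j. X i k)" if "j \<le> n" for i j
  proof -
    have "take j (map (X i) [1..<Suc n]) = map (X i) [1..<Suc j]"
      using that by (simp add: take_map del: upt_Suc)
    then show ?thesis
      by (simp add: interv_sum_list_conv_sum_set_nat atLeastLessThanSuc_atLeastAtMost del: upt_Suc)
  qed
  have all: "sum_list (map (X i) [1..<Suc n]) = (\<Sum>k=1..n. X i k)" for i
    using take[of n i] by simp
  have row: "(\<forall>j\<in>{1..n}. X i j \<in> {0, 1, -1}) \<and> alternating_line (map (X i) [1..<Suc n]) \<longleftrightarrow>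
    (\<forall>j\<le>n. (\<Sum>k=1..j. X i k) \<in> {0, 1}) \<and> (\<Sum>k=1..n. X i k) = 1" for i
    using alternating_line_iff_prefix_sums[of "map (X i) [1..<Suc n]"] take all
    by (auto simp: image_subset_iff simp del: upt_Suc)
  have "is_DSASM n X \<longleftrightarrow>
      (\<forall>i\<in>{1..n}. (\<forall>j\<in>{1..n}. X i j \<in> {0, 1, -1}) \<and> alternating_line (map (X i) [1..<Suc n]))"
    unfolding is_DSASM_def is_ASM_def using True col by blast
  then show ?thesis
    unfolding row using True by blast
next
  case False
  then show ?thesis
    unfolding is_DSASM_def by blast
qed

section \<open>Cores, symmetric completions and corner sums\<close>

definition sym_entry :: "real ^ ('n::finite) core_pos \<Rightarrow> nat \<Rightarrow> nat \<Rightarrow> real" where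
  "sym_entry Y i j = entry Y (min i j) (max i j)"

text \<open>Reflection in the diagonal carries the part of column \<open>i\<close> in the first sum
  of \<open>L\<close> to the initial part of row \<open>i\<close>. Hence \<open>L i j\<close> is a
  prefix sum of row \<open>i\<close> of the full symmetric matrix.\<close>

lemma L_eq_sum_sym_entry: "L i j Y = (\<Sum>k=1..j. sym_entry Y i k)"
proof -
  have "{1..j} = {1..min i j} \<union> {i+1..j}" "{1..min i j} \<inter> {i+1..j} = {}"
    by auto
  then have "(\<Sum>k=1..j. sym_entry Y i k) = (\<Sum>k=1..min i j. sym_entry Y i k) + (\<Sum>k=i+1..j. sym_entry Y i k)"
    by (simp add: sum.union_disjoint)
  also have "(\<Sum>k=1..min i j. sym_entry Y i k) = (\<Sum>k=1..min i j. entry Y k i)"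
    by (rule sum.cong) (auto simp: sym_entry_def)
  also have "(\<Sum>k=i+1..j. sym_entry Y i k) = (\<Sum>k=i+1..j. entry Y i k)"
    by (rule sum.cong) (auto simp: sym_entry_def)
  finally show ?thesis
    by (simp add: L_def)
qed

lemma L_0 [simp]: "L i 0 Y = 0"
  by (simp add: L_def)

lemma sym_entry_commute: "sym_entry Y i j = sym_entry Y j i"
  by (simp add: sym_entry_def min.commute max.commute)

lemma sym_entry_eq_L_diff: "1 \<le> j \<Longrightarrow> sym_entry Y i j = L i j Y - L i (j - 1) Y"
  by (cases j) (simp_all add: L_eq_sum_sym_entry)

lemma linear_L: "linear (L i j)"
  by (rule linearI) (simp_all add: L_def entry_def sum.distrib sum_distrib_left distrib_left)

lemma component_eq_sym_entry:
  fixes Y :: "real ^ ('n::finite) core_pos"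
  obtains i j where "Rep_core_pos p = (i, j)" "1 \<le> i" "i \<le> j" "j \<le> CARD('n)" "Y $ p = sym_entry Y i j"
proof -
  obtain i j where ij: "Rep_core_pos p = (i, j)"
    by fastforce
  then have "Abs_core_pos (i, j) = p"
    by (metis Rep_core_pos_inverse)
  then show thesis
    using that[OF ij] Rep_core_pos[of p] ij by (auto simp: sym_entry_def entry_def)
qed

lemma core_eqI:
  fixes Y Z :: "real ^ ('n::finite) core_pos"
  assumes "\<And>i j. i \<in> {1..CARD('n)} \<Longrightarrow> j \<le> CARD('n) \<Longrightarrow> L i j Y = L i j Z"
  shows "Y = Z"
  unfolding vec_eq_iff
proof
  fix p
  obtain i j where ij: "Rep_core_pos p = (i, j)" "1 \<le> i" "i \<le> j" "j \<le> CARD('n)"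
      and Y: "Y $ p = sym_entry Y i j"
    by (rule component_eq_sym_entry)
  obtain i' j' where "Rep_core_pos p = (i', j')" "Z $ p = sym_entry Z i' j'"
    by (rule component_eq_sym_entry)
  then have Z: "Z $ p = sym_entry Z i j"
    using ij(1) by simp
  have "L i j Y = L i j Z" "L i (j - 1) Y = L i (j - 1) Z"
    using assms[of i j] assms[of i "j - 1"] ij by auto
  then show "Y $ p = Z $ p"
    unfolding Y Z using ij by (simp add: sym_entry_eq_L_diff)
qed

lemma sym_entry_core:
  assumes "\<And>i j. i \<in> {1..CARD('n::finite)} \<Longrightarrow> j \<in> {1..CARD('n)} \<Longrightarrow> X i j = X j i"
    and "i \<in> {1..CARD('n)}" "j \<in> {1..CARD('n)}"
  shows "sym_entry (core X :: real ^ 'n core_pos) i j = X i j"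
proof -
  have "Rep_core_pos (Abs_core_pos (min i j, max i j) :: 'n core_pos) = (min i j, max i j)"
    using assms(2,3) by (intro Abs_core_pos_inverse) (auto simp: min_def max_def)
  then show ?thesis
    using assms by (auto simp: sym_entry_def entry_def core_def min_def max_def)
qed

lemma L_core:
  assumes "\<And>i j. i \<in> {1..CARD('n::finite)} \<Longrightarrow> j \<in> {1..CARD('n)} \<Longrightarrow> X i j = X j i"
    and "i \<in> {1..CARD('n)}" "j \<le> CARD('n)"
  shows "L i j (core X :: real ^ 'n core_pos) = (\<Sum>k=1..j. X i k)"
  unfolding L_eq_sum_sym_entry using assms(2,3) by (intro sum.cong refl sym_entry_core[OF assms(1)]) auto

lemma core_sym_entry: "core (sym_entry Y) = Y"
proof -
  have "core (sym_entry Y) $ p = Y $ p" for p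
  proof -
    obtain i j where "Rep_core_pos p = (i, j)" "Y $ p = sym_entry Y i j"
      by (rule component_eq_sym_entry)
    then show ?thesis
      by (simp add: core_def)
  qed
  then show ?thesis
    by (simp add: vec_eq_iff)
qed

text \<open>The corner sums of the symmetric matrix with core \<open>Y\<close>; in these coordinates every \<open>L i j\<close>
  becomes a difference of two coordinates.\<close>

definition height :: "real ^ ('n::finite) core_pos \<Rightarrow> nat \<Rightarrow> nat \<Rightarrow> real" where
  "height Y i j = (\<Sum>k=1..i. L k j Y)"

text \<open>The mixed second difference inverts corner summation for symmetric \<open>h\<close> that
  vanish on the axes.\<close>

definition of_height :: "(nat \<Rightarrow> nat \<Rightarrow> real) \<Rightarrow> real ^ ('n::finite) core_pos" where
  "of_height h = core (\<lambda>i j. h i j - h (i - 1) j - h i (j - 1) + h (i - 1) (j - 1))"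

lemma height_commute: "height Y i j = height Y j i"
  unfolding height_def L_eq_sum_sym_entry by (subst sum.swap) (simp add: sym_entry_commute)

lemma height_0 [simp]: "height Y 0 j = 0"
  by (simp add: height_def)

lemma height_diff: "1 \<le> i \<Longrightarrow> height Y i j - height Y (i - 1) j = L i j Y"
  by (cases i) (simp_all add: height_def)

text \<open>The sum along row \<open>i\<close> telescopes. Symmetry makes the matrix symmetric and
  also turns the vanishing of \<open>h 0 i\<close> into that of \<open>h i 0\<close>.\<close>

lemma L_of_height:
  assumes sym: "\<And>i j. h i j = h j i" and zero: "\<And>j. j \<le> CARD('n::finite) \<Longrightarrow> h 0 j = 0"
    and "i \<in> {1..CARD('n)}" "j \<le> CARD('n)"
  shows "L i j (of_height h :: real ^ 'n core_pos) = h i j - h (i - 1) j"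
proof -
  have "(\<Sum>k=1..j. h i k - h (i - 1) k - h i (k - 1) + h (i - 1) (k - 1)) =
      h i j - h (i - 1) j - (h i 0 - h (i - 1) 0)"
    by (induction j) auto
  moreover have "h i 0 = 0" "h (i - 1) 0 = 0"
    using zero[of i] zero[of "i - 1"] sym[of _ 0] assms(3) by auto
  moreover have "L i j (of_height h :: real ^ 'n core_pos) =
      (\<Sum>k=1..j. h i k - h (i - 1) k - h i (k - 1) + h (i - 1) (k - 1))"
    unfolding of_height_def
  proof (rule L_core[OF _ assms(3,4)])
    show "h i j - h (i - 1) j - h i (j - 1) + h (i - 1) (j - 1) =
        h j i - h (j - 1) i - h j (i - 1) + h (j - 1) (i - 1)" for i j
      using sym[of i j] sym[of "i - 1" j] sym[of i "j - 1"] sym[of "i - 1" "j - 1"] by linarith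
  qed
  ultimately show ?thesis
    by simp
qed

section \<open>The polytope of partial row sums\<close>

text \<open>The equations are kept apart from the inequalities because this set serves as the
  ambient affine space in the facet argument.\<close>

definition row_sum_space :: "(real ^ ('n::finite) core_pos) set" where
  "row_sum_space = {Y. \<forall>i\<in>{1..CARD('n)}. L i CARD('n) Y = 1}"

definition partial_sum_polytope :: "(real ^ ('n::finite) core_pos) set" where
  "partial_sum_polytope =
    {Y \<in> row_sum_space. \<forall>i\<in>{1..CARD('n)}. \<forall>j\<le>CARD('n). 0 \<le> L i j Y \<and> L i j Y \<le> 1}"

lemma affine_row_sum_space: "affine row_sum_space"
  by (auto simp: affine_def row_sum_space_def linear_add[OF linear_L] linear_scale[OF linear_L])

lemma compact_partial_sum_polytope: "compact (partial_sum_polytope :: (real ^ ('n::finite) core_pos) set)"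
proof -
  have cont: "continuous_on UNIV (L i j)" for i j
    using linear_L[of i j] linear_conv_bounded_linear linear_continuous_on by blast
  have "partial_sum_polytope = (\<Inter>i\<in>{1..CARD('n)}. {Y. L i CARD('n) Y = 1}) \<inter>
      (\<Inter>i\<in>{1..CARD('n)}. \<Inter>j\<in>{..CARD('n)}. {Y::real ^ 'n core_pos. 0 \<le> L i j Y} \<inter> {Y. L i j Y \<le> 1})"
    by (auto simp: partial_sum_polytope_def row_sum_space_def)
  also have "closed \<dots>"
    by (intro closed_Int closed_INT ballI closed_Collect_le closed_Collect_eq cont continuous_on_const)
  finally have "closed (partial_sum_polytope :: (real ^ 'n core_pos) set)" .
  moreover have "norm Y \<le> real CARD('n core_pos)"
    if Y: "Y \<in> partial_sum_polytope" for Y :: "real ^ 'n core_pos"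
  proof -
    \<comment> \<open>Every component is a difference of two partial row sums, both between 0 and
      1.\<close>
    have "\<bar>Y $ p\<bar> \<le> 1" for p
    proof -
      obtain i j where "Rep_core_pos p = (i, j)" "1 \<le> i" "i \<le> j" "j \<le> CARD('n)" "Y $ p = sym_entry Y i j"
        by (rule component_eq_sym_entry)
      moreover from this have "0 \<le> L i j Y" "L i j Y \<le> 1" "0 \<le> L i (j - 1) Y" "L i (j - 1) Y \<le> 1"
        using Y by (auto simp: partial_sum_polytope_def)
      ultimately show ?thesis
        by (simp add: sym_entry_eq_L_diff)
    qed
    then have "(\<Sum>p\<in>UNIV. \<bar>Y $ p\<bar>) \<le> real CARD('n core_pos)"
      using sum_bounded_above[of UNIV "\<lambda>p. \<bar>Y $ p\<bar>" 1] by simp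
    then show ?thesis
      using norm_le_l1_cart[of Y] by linarith
  qed
  ultimately show ?thesis
    unfolding compact_eq_bounded_closed bounded_iff by blast
qed

lemma convex_partial_sum_polytope: "convex partial_sum_polytope"
proof -
  have "u * x + v * y \<le> 1" if "0 \<le> u" "0 \<le> v" "u + v = 1" "x \<le> 1" "y \<le> 1" for u v x y :: real
    using convex_bound_le that by blast
  then show ?thesis
    by (auto simp: convex_def partial_sum_polytope_def row_sum_space_def linear_add[OF linear_L] linear_scale[OF linear_L])
qed

lemma core_DSASM_in_partial_sum_polytope:
  assumes "is_DSASM CARD('n) X"
  shows "(core X :: real ^ ('n::finite) core_pos) \<in> partial_sum_polytope"
proof -
  have X: "\<And>i j. i \<in> {1..CARD('n)} \<Longrightarrow> j \<in> {1..CARD('n)} \<Longrightarrow> X i j = X j i"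
    "\<And>i. i \<in> {1..CARD('n)} \<Longrightarrow> (\<forall>j\<le>CARD('n). (\<Sum>k=1..j. X i k) \<in> {0, 1}) \<and> (\<Sum>k=1..CARD('n). X i k) = 1"
    using assms unfolding is_DSASM_iff_prefix_sums by blast+
  have L: "L i j (core X :: real ^ 'n core_pos) = (\<Sum>k=1..j. X i k)"
    if "i \<in> {1..CARD('n)}" "j \<le> CARD('n)" for i j
    using that X(1) by (intro L_core)
  have "0 \<le> L i j (core X :: real ^ 'n core_pos) \<and> L i j (core X :: real ^ 'n core_pos) \<le> 1"
    if "i \<in> {1..CARD('n)}" "j \<le> CARD('n)" for i j
  proof -
    have "(\<Sum>k=1..j. X i k) \<in> {0, 1}"
      using X(2) that by blast
    then show ?thesis
      unfolding L[OF that] by auto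
  qed
  moreover have "L i CARD('n) (core X :: real ^ 'n core_pos) = 1" if "i \<in> {1..CARD('n)}" for i
    unfolding L[OF that order_refl] using X(2)[OF that] by blast
  ultimately show ?thesis
    unfolding partial_sum_polytope_def row_sum_space_def by blast
qed

lemma integral_core_is_DSASM:
  fixes Y :: "real ^ ('n::finite) core_pos"
  assumes Y: "Y \<in> partial_sum_polytope"
    and int: "\<And>i j. i \<in> {1..CARD('n)} \<Longrightarrow> j \<le> CARD('n) \<Longrightarrow> L i j Y \<in> \<int>"
  shows "Y \<in> core ` {X. is_DSASM CARD('n) X}"
proof
  have "L i j Y \<in> {0, 1}" if "i \<in> {1..CARD('n)}" "j \<le> CARD('n)" for i j
  proof -
    have "L i j Y \<in> \<int>"
      using int that by blast
    then obtain m where m: "L i j Y = of_int m"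
      using Ints_cases by blast
    have "0 \<le> L i j Y" "L i j Y \<le> 1"
      using Y that by (auto simp: partial_sum_polytope_def)
    then have "m = 0 \<or> m = 1"
      unfolding m by simp linarith
    then show ?thesis
      by (auto simp: m)
  qed
  then show "sym_entry Y \<in> {X. is_DSASM CARD('n) X}"
    unfolding mem_Collect_eq is_DSASM_iff_prefix_sums L_eq_sum_sym_entry[symmetric]
    using Y sym_entry_commute[of Y] by (simp add: partial_sum_polytope_def row_sum_space_def)
qed (simp add: core_sym_entry)

section \<open>Integrality of extreme points\<close>

text \<open>The difference of the squared sines of \<open>a\<close> and \<open>b\<close> is
  \<open>sin (a + b) * sin (a - b)\<close>. The bound 4 replaces \<open>pi\<close> and cancels
  against the division by 4 in the perturbation.\<close>

lemma sin_pi_squared_lipschitz: "\<bar>(sin (pi * x))\<^sup>2 - (sin (pi * y))\<^sup>2\<bar> \<le> 4 * \<bar>x - y\<bar>"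
proof -
  have "(sin (pi * x))\<^sup>2 - (sin (pi * y))\<^sup>2 = sin (pi * x + pi * y) * sin (pi * x - pi * y)"
    using sin_cos_squared_add[of "pi * x"] sin_cos_squared_add[of "pi * y"]
    unfolding sin_add sin_diff by algebra
  then have "\<bar>(sin (pi * x))\<^sup>2 - (sin (pi * y))\<^sup>2\<bar> = \<bar>sin (pi * x + pi * y)\<bar> * \<bar>sin (pi * x - pi * y)\<bar>"
    by (simp add: abs_mult)
  also have "\<dots> \<le> 1 * \<bar>pi * x - pi * y\<bar>"
    by (intro mult_mono abs_sin_le_one abs_sin_x_le_abs_x) auto
  also have "\<dots> = pi * \<bar>x - y\<bar>"
    by (simp add: abs_mult flip: right_diff_distrib)
  also have "\<dots> \<le> 4 * \<bar>x - y\<bar>"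
    using pi_less_4 by (intro mult_right_mono) auto
  finally show ?thesis .
qed

lemma sin_pi_squared_periodic: "(sin (pi * (x + 1)))\<^sup>2 = (sin (pi * x))\<^sup>2"
  by (simp add: distrib_left sin_add)

text \<open>Perturbing all heights by \<open>x \<mapsto> x \<plusminus> sin\<^sup>2(\<pi>x)/4\<close>, which is monotone, commutes with
  \<open>x \<mapsto> x + 1\<close> and fixes exactly the integers, does not leave the polytope.\<close>

lemma extreme_point_integral:
  fixes Y :: "real ^ ('n::finite) core_pos"
  assumes ext: "Y extreme_point_of partial_sum_polytope" and "i \<in> {1..CARD('n)}" "j \<le> CARD('n)"
  shows "L i j Y \<in> \<int>"
proof -
  define s :: "real \<Rightarrow> real" where "s x = (sin (pi * x))\<^sup>2 / 4" for x
  have lip: "\<bar>s x - s y\<bar> \<le> \<bar>x - y\<bar>" for x y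
    using sin_pi_squared_lipschitz[of x y] by (simp add: s_def abs_le_iff)
  have per: "s (x + 1) = s x" for x
    by (simp add: s_def sin_pi_squared_periodic)
  define Z :: "real \<Rightarrow> real ^ 'n core_pos" where
    "Z c = of_height (\<lambda>i j. height Y i j + c * s (height Y i j))" for c
  have Y: "Y \<in> partial_sum_polytope"
    using ext by (simp add: extreme_point_of_def)
  have LZ: "L i j (Z c) = L i j Y + c * (s (height Y i j) - s (height Y (i - 1) j))"
    if "i \<in> {1..CARD('n)}" "j \<le> CARD('n)" for i j c
  proof -
    have "L i j (Z c) = height Y i j + c * s (height Y i j) - (height Y (i - 1) j + c * s (height Y (i - 1) j))"
      unfolding Z_def using that by (intro L_of_height) (auto simp: height_commute[of Y] s_def)
    then show ?thesis
      using that height_diff[of i Y j] by (simp add: algebra_simps)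
  qed
  have Z: "Z c \<in> partial_sum_polytope" if c: "\<bar>c\<bar> = 1" for c
  proof -
    have "0 \<le> L i j (Z c) \<and> L i j (Z c) \<le> 1 \<and> (j = CARD('n) \<longrightarrow> L i j (Z c) = 1)"
      if ij: "i \<in> {1..CARD('n)}" "j \<le> CARD('n)" for i j
    proof -
      let ?a = "height Y i j" and ?b = "height Y (i - 1) j"
      have d: "?a - ?b = L i j Y" "0 \<le> L i j Y" "L i j Y \<le> 1" "j = CARD('n) \<Longrightarrow> L i j Y = 1"
        using Y ij height_diff[of i Y j] by (auto simp: partial_sum_polytope_def row_sum_space_def)
      have "\<bar>s ?a - s ?b\<bar> \<le> L i j Y"
        using lip[of ?a ?b] d by simp
      \<comment> \<open>Since \<open>s\<close> has period 1, \<open>?b\<close> may be replaced by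
        \<open>?b + 1\<close>, whose distance from \<open>?a\<close> is \<open>1 - L i j Y\<close>.
        This keeps the upper bound and also the equations \<open>L i n = 1\<close>.\<close>
      moreover have "\<bar>s ?a - s ?b\<bar> \<le> 1 - L i j Y"
        using lip[of ?a "?b + 1"] per[of ?b] d by simp
      moreover have "\<bar>c * (s ?a - s ?b)\<bar> = \<bar>s ?a - s ?b\<bar>"
        by (simp add: abs_mult c)
      ultimately have "0 \<le> L i j (Z c)" "L i j (Z c) \<le> 1" "L i j Y = 1 \<Longrightarrow> L i j (Z c) = 1"
        unfolding LZ[OF ij] by linarith+
      then show ?thesis
        using d(4) by blast
    qed
    then show ?thesis
      unfolding partial_sum_polytope_def row_sum_space_def by blast
  qed
  have "midpoint (Z 1) (Z (- 1)) = Y"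
    by (rule core_eqI)
      (simp add: midpoint_def LZ linear_scale[OF linear_L] linear_add[OF linear_L])
  then have "Y \<notin> open_segment (Z 1) (Z (- 1)) \<Longrightarrow> Z 1 = Z (- 1)"
    using midpoint_in_open_segment by metis
  then have eq: "Z 1 = Z (- 1)"
    using ext Z[of 1] Z[of "- 1"] by (simp add: extreme_point_of_def)
  \<comment> \<open>Equality of the two perturbations makes \<open>s\<close> constant down each
    column of heights, starting from \<open>s 0 = 0\<close>. Its zeros are the integers.\<close>
  have step: "s (height Y i j) = s (height Y (i - 1) j)" if "i \<in> {1..CARD('n)}" for i
    using LZ[OF that assms(3), of 1] LZ[OF that assms(3), of "- 1"] unfolding eq by simp
  have "s (height Y i j) = 0" if "i \<le> CARD('n)" for i
    using that
  proof (induction i)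
    case (Suc i)
    then show ?case
      using step[of "Suc i"] by simp
  qed (simp add: s_def)
  then have int: "height Y i j \<in> \<int>" if "i \<le> CARD('n)" for i
    using that by (simp add: s_def mult.commute[of pi] sin_times_pi_eq_0)
  have "height Y i j - height Y (i - 1) j \<in> \<int>"
    using assms(2) by (intro Ints_diff int) auto
  then show ?thesis
    using height_diff[of i Y j] assms(2) by simp
qed

lemma P_core_DSASM_eq_partial_sum_polytope: "P_core_DSASM = partial_sum_polytope"
proof
  show "P_core_DSASM \<subseteq> partial_sum_polytope"
    unfolding P_core_DSASM_def
    by (intro hull_minimal convex_partial_sum_polytope)
      (use core_DSASM_in_partial_sum_polytope in blast)
  have "Y \<in> core ` {X. is_DSASM CARD('a) X}" if ext: "Y extreme_point_of partial_sum_polytope"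
    for Y :: "real ^ 'a core_pos"
    using ext extreme_point_integral[OF ext] by (intro integral_core_is_DSASM) (simp_all add: extreme_point_of_def)
  then have "{Y. Y extreme_point_of (partial_sum_polytope :: (real ^ 'a core_pos) set)} \<subseteq> core ` {X. is_DSASM CARD('a) X}"
    by blast
  then show "(partial_sum_polytope :: (real ^ 'a core_pos) set) \<subseteq> P_core_DSASM"
    unfolding P_core_DSASM_def
    using Krein_Milman_Minkowski[OF compact_partial_sum_polytope convex_partial_sum_polytope]
    by (metis hull_mono)
qed

subsection \<open>Irredundancy\<close>

text \<open>The index sets are taken over \<open>int\<close> so that \<open>i - 1\<close> and
  \<open>n - j\<close> are true subtractions in the witness computations.\<close>

definition lower_pos :: "int \<Rightarrow> (int \<times> int) set" where
  "lower_pos n = {2..n-1} \<times> {2..n-2} \<union> {1..n} \<times> {1}"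

definition upper_pos :: "int \<Rightarrow> (int \<times> int) set" where
  "upper_pos n = {2..n-1} \<times> {2..n-2} \<union> {2..n} \<times> {n-1}"

text \<open>Here \<open>h\<close> plays the role of a matrix of corner sums. Apart from the boundary case \<open>(n, 1)\<close>, the
  witnesses are corner sums of a DSASM that agree at \<open>(i0, j0)\<close>, \<open>(i0 - 1, j0)\<close>, \<open>(i0 + 1, j0)\<close> and
  \<open>(i0, j0 + 1)\<close>, then lowered by 1 at \<open>(i0, j0)\<close> and its transpose.\<close>

lemma lower_witness:
  fixes n :: int
  assumes n: "n \<ge> 3" and k: "(i0, j0) \<in> lower_pos n"
  obtains h :: "int \<Rightarrow> int \<Rightarrow> int" where
    "\<And>i j. h i j = h j i" "\<And>j. j \<in> {0..n} \<Longrightarrow> h 0 j = 0 \<and> h n j = j"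
    "h i0 j0 - h (i0 - 1) j0 < 0"
    "\<And>i j. (i, j) \<in> lower_pos n - {(i0, j0)} \<Longrightarrow> 0 \<le> h i j - h (i - 1) j"
    "\<And>i j. (i, j) \<in> upper_pos n \<Longrightarrow> h i j - h (i - 1) j \<le> 1"
proof -
  consider "i0 = n" "j0 = 1" | "1 \<le> j0" "j0 < i0" "i0 \<le> n - 1"
    | "1 \<le> i0" "i0 \<le> j0" "j0 \<le> n - 2" "i0 = j0 \<or> 2 \<le> i0"
    using k n by (force simp: lower_pos_def)
  then show thesis
  proof cases
    case 1
    \<comment> \<open>Row \<open>n\<close> of \<open>h\<close> is prescribed, so the corner sums of
      the identity are raised just above \<open>(n, 1)\<close> instead. The transposed change makes
      the difference at \<open>(1, n - 1)\<close> equal to 2, which no listed inequality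
      forbids.\<close>
    define h where "h i j = min i j + (if (i, j) \<in> {(n - 1, 1), (1, n - 1)} then 1 else 0)" for i j
    show thesis
    proof (rule that[of h])
      show "\<And>i j. (i, j) \<in> lower_pos n - {(i0, j0)} \<Longrightarrow> 0 \<le> h i j - h (i - 1) j"
        using 1 n by (auto simp: h_def lower_pos_def min_def)
      show "\<And>i j. (i, j) \<in> upper_pos n \<Longrightarrow> h i j - h (i - 1) j \<le> 1"
        using 1 n by (auto simp: h_def upper_pos_def min_def)
    qed (use 1 n in \<open>auto simp: h_def min_def\<close>)
  next
    case 2
    \<comment> \<open>Before lowering, these are the corner sums of an identity block of size
      \<open>j0\<close> followed by an antidiagonal block of size \<open>n - j0\<close>.\<close>
    define h where "h i j = max (i + j - n) (min (min i j) j0) -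
      (if (i, j) \<in> {(i0, j0), (j0, i0)} then 1 else 0)" for i j
    show thesis
    proof (rule that[of h])
      show "\<And>i j. (i, j) \<in> lower_pos n - {(i0, j0)} \<Longrightarrow> 0 \<le> h i j - h (i - 1) j"
        using 2 n by (auto simp: h_def lower_pos_def min_def max_def)
      show "\<And>i j. (i, j) \<in> upper_pos n \<Longrightarrow> h i j - h (i - 1) j \<le> 1"
        using 2 n by (auto simp: h_def upper_pos_def min_def max_def)
    qed (use 2 n in \<open>auto simp: h_def min_def max_def\<close>)
  next
    case 3
    \<comment> \<open>Between the extreme corner sums \<open>max 0 (i + j - n)\<close> and
      \<open>min i j\<close>, a cap creates a plateau of height \<open>i0 - 1\<close> where
      \<open>max i j\<close> is at least \<open>j0\<close>. Below \<open>j0\<close> the cap falls by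
      1 per step, which leaves room to lower the transposed position as well.\<close>
    define g where "g i j = max (max 0 (i + j - n)) (min (min i j) (i0 - 1 - max 0 (j0 - max i j)))" for i j
    have sym: "g i j = g j i" for i j
      unfolding g_def by (simp add: min.commute max.commute add.commute)
    \<comment> \<open>Each function inside the maxima and minima grows by 0 or 1 when
      \<open>i\<close> does.\<close>
    have step: "0 \<le> g i j - g (i - 1) j" "g i j - g (i - 1) j \<le> 1" for i j
      unfolding g_def by linarith+
    have bd: "g 0 j = 0 \<and> g n j = j" if "j \<in> {0..n}" for j
      using that 3 n unfolding g_def by auto
    \<comment> \<open>The values below the two lowered positions need \<open>j0\<close> at most
      \<open>n - 2\<close>. The last equation needs \<open>i0\<close> at least 2 and provides the
      slack above the transposed position.\<close>
    have near: "g i0 j0 = i0 - 1" "g (i0 - 1) j0 = i0 - 1" "g (i0 + 1) j0 = i0 - 1"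
      "g (j0 + 1) i0 = i0 - 1" "i0 < j0 \<Longrightarrow> g (j0 - 1) i0 = i0 - 2"
      using 3 unfolding g_def by (auto simp: max_def min_def)
    define h where "h i j = g i j - (if (i, j) \<in> {(i0, j0), (j0, i0)} then 1 else 0)" for i j
    have hg: "h i j \<le> g i j" "(i, j) \<notin> {(i0, j0), (j0, i0)} \<Longrightarrow> h i j = g i j"
      "(i, j) \<in> {(i0, j0), (j0, i0)} \<Longrightarrow> h i j = i0 - 2" for i j
      using near(1) sym[of i0 j0] by (auto simp: h_def)
    show thesis
    proof (rule that[of h])
      show "0 \<le> h i j - h (i - 1) j" if ij: "(i, j) \<in> lower_pos n - {(i0, j0)}" for i j
      proof (cases "(i, j) = (j0, i0)")
        case True
        then have "i0 < j0"
          using ij 3 by auto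
        then show ?thesis
          using True hg(3)[of j0 i0] hg(1)[of "j0 - 1" i0] near(5) by simp
      next
        case False
        then show ?thesis
          using step(1)[of i j] hg(2)[of i j] hg(1)[of "i - 1" j] ij by simp
      qed
      show "h i j - h (i - 1) j \<le> 1" if "(i, j) \<in> upper_pos n" for i j
      proof (cases "(i - 1, j) \<in> {(i0, j0), (j0, i0)}")
        case True
        then have "g i j = i0 - 1"
          using near(3,4) by (metis Pair_inject diff_add_cancel insertE singletonD)
        then show ?thesis
          using hg(3)[OF True] hg(1)[of i j] by simp
      next
        case False
        then show ?thesis
          using step(2)[of i j] hg(2)[of "i - 1" j] hg(1)[of i j] by simp
      qed
      show "h i0 j0 - h (i0 - 1) j0 < 0"
        using near(2) hg(2)[of "i0 - 1" j0] hg(3)[of i0 j0] 3 by simp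
      show "h i j = h j i" for i j
        using sym[of i j] by (auto simp: h_def)
      show "h 0 j = 0 \<and> h n j = j" if "j \<in> {0..n}" for j
        using bd[OF that] 3 n by (auto simp: h_def)
    qed
  qed
qed

text \<open>The half-turn of the matrix exchanges the two families of inequalities, except that
  \<open>(n, 1)\<close> has no partner.\<close>

lemma upper_witness:
  fixes n :: int
  assumes n: "n \<ge> 3" and k: "(i0, j0) \<in> upper_pos n"
  obtains h :: "int \<Rightarrow> int \<Rightarrow> int" where
    "\<And>i j. h i j = h j i" "\<And>j. j \<in> {0..n} \<Longrightarrow> h 0 j = 0 \<and> h n j = j"
    "h i0 j0 - h (i0 - 1) j0 > 1"
    "\<And>i j. (i, j) \<in> lower_pos n \<Longrightarrow> 0 \<le> h i j - h (i - 1) j"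
    "\<And>i j. (i, j) \<in> upper_pos n - {(i0, j0)} \<Longrightarrow> h i j - h (i - 1) j \<le> 1"
proof -
  have k': "(n + 1 - i0, n - j0) \<in> lower_pos n" "(n + 1 - i0, n - j0) \<noteq> (n, 1)"
    using k n by (auto simp: lower_pos_def upper_pos_def)
  from lower_witness[OF n k'(1)] obtain g :: "int \<Rightarrow> int \<Rightarrow> int" where g:
    "\<And>i j. g i j = g j i" "\<And>j. j \<in> {0..n} \<Longrightarrow> g 0 j = 0 \<and> g n j = j"
    "g (n + 1 - i0) (n - j0) - g (n + 1 - i0 - 1) (n - j0) < 0"
    "\<And>i j. (i, j) \<in> lower_pos n - {(n + 1 - i0, n - j0)} \<Longrightarrow> 0 \<le> g i j - g (i - 1) j"
    "\<And>i j. (i, j) \<in> upper_pos n \<Longrightarrow> g i j - g (i - 1) j \<le> 1"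
    by blast
  \<comment> \<open>Inclusion-exclusion gives the corner sums after a half-turn of a matrix with
    corner sums \<open>g\<close> and all line sums 1.\<close>
  define h where "h i j = i + j - n + g (n - i) (n - j)" for i j
  have diff: "h i j - h (i - 1) j = 1 - (g (n + 1 - i) (n - j) - g (n + 1 - i - 1) (n - j))" for i j
    by (simp add: h_def algebra_simps)
  show thesis
  proof (rule that[of h])
    show "h i j = h j i" for i j
      using g(1)[of "n - i" "n - j"] by (simp add: h_def)
    show "h 0 j = 0 \<and> h n j = j" if "j \<in> {0..n}" for j
      using g(2)[of "n - j"] that by (simp add: h_def)
    show "h i0 j0 - h (i0 - 1) j0 > 1"
      using g(3) unfolding diff by simp
    show "0 \<le> h i j - h (i - 1) j" if "(i, j) \<in> lower_pos n" for i j
    \<comment> \<open>The partner \<open>(1, n - 1)\<close> is not in \<open>upper_pos n\<close>. By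
      symmetry of \<open>g\<close> the required inequality is instead the one for \<open>g\<close>
      at \<open>(n, 1)\<close> itself.\<close>
    proof (cases "(i, j) = (n, 1)")
      case True
      have "(n, 1) \<in> lower_pos n"
        using n by (auto simp: lower_pos_def)
      then have "g (n - 1) 1 \<le> g n 1"
        using g(4)[of n 1] k'(2) by simp
      then show ?thesis
        using True g(1)[of 1 "n - 1"] g(2)[of 1] g(2)[of "n - 1"] n unfolding diff by simp
    next
      case False
      then have "(n + 1 - i, n - j) \<in> upper_pos n"
        using that by (auto simp: lower_pos_def upper_pos_def)
      from g(5)[OF this] show ?thesis
        unfolding diff by simp
    qed
    show "h i j - h (i - 1) j \<le> 1" if "(i, j) \<in> upper_pos n - {(i0, j0)}" for i j
    proof -
      have "(n + 1 - i, n - j) \<in> lower_pos n - {(n + 1 - i0, n - j0)}"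
        using that n by (auto simp: lower_pos_def upper_pos_def)
      from g(4)[OF this] show ?thesis
        unfolding diff by simp
    qed
  qed
qed

section \<open>Reduction to the listed inequalities\<close>

text \<open>The listed inequalities in columns 1 and \<open>n - 1\<close> make the first and last
  rows non-negative. As these rows sum to 1, their partial sums and entries lie between 0 and 1,
  which yields the missing bounds in rows 1 and \<open>n\<close> and in columns 1 and
  \<open>n - 1\<close>.\<close>

lemma partial_sum_polytope_eq_reduced_system:
  fixes P :: "(real ^ ('n::finite) core_pos) set"
  assumes n: "n = CARD('n)" "n \<ge> 3"
    and P: "P = {Y \<in> row_sum_space.
      (\<forall>(i, j)\<in>{2..n-1} \<times> {2..n-2} \<union> {1..n} \<times> {1}. 0 \<le> L i j Y) \<and>
      (\<forall>(i, j)\<in>{2..n-1} \<times> {2..n-2} \<union> {2..n} \<times> {n-1}. L i j Y \<le> 1)}"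
  shows "partial_sum_polytope = P"
proof
  show "partial_sum_polytope \<subseteq> P"
    unfolding P partial_sum_polytope_def using n by auto
  show "P \<subseteq> partial_sum_polytope"
  proof
    fix Y assume "Y \<in> P"
    then have Y: "Y \<in> row_sum_space"
      and lower: "\<And>i j. (i, j) \<in> {2..n-1} \<times> {2..n-2} \<union> {1..n} \<times> {1} \<Longrightarrow> 0 \<le> L i j Y"
      and upper: "\<And>i j. (i, j) \<in> {2..n-1} \<times> {2..n-2} \<union> {2..n} \<times> {n-1} \<Longrightarrow> L i j Y \<le> 1"
      unfolding P by blast+
    let ?e = "sym_entry Y"
    have total: "L i n Y = 1" if "i \<in> {1..n}" for i
      using Y that n by (simp add: row_sum_space_def)
    have first: "?e 1 k = L k 1 Y" for k
      using sym_entry_eq_L_diff[of 1 Y k] sym_entry_commute[of Y 1 k] by simp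
    have last: "?e n k = 1 - L k (n - 1) Y" if "k \<in> {1..n}" for k
      using sym_entry_eq_L_diff[of n Y k] sym_entry_commute[of Y n k] total[OF that] n by simp
    have nonneg1: "0 \<le> ?e 1 k" if "k \<in> {1..n}" for k
      unfolding first using lower that by simp
    have nonnegn: "0 \<le> ?e n k" if k: "k \<in> {1..n}" for k
    \<comment> \<open>The bound at \<open>(1, n - 1)\<close> is not listed, but the corner entry
      also lies in the first row, where \<open>(n, 1)\<close> makes it non-negative.\<close>
    proof (cases "k = 1")
      case True
      then show ?thesis
        using nonneg1[of n] n sym_entry_commute[of Y 1 n] by simp
    next
      case False
      then show ?thesis
        unfolding last[OF k] using upper[of k "n - 1"] k by simp
    qed
    have row: "0 \<le> L m j Y \<and> L m j Y \<le> 1 \<and> (j \<in> {1..n} \<longrightarrow> ?e m j \<le> 1)"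
      if nonneg: "\<And>k. k \<in> {1..n} \<Longrightarrow> 0 \<le> ?e m k" and m: "m \<in> {1..n}" and j: "j \<le> n" for m j
    proof -
      have "L m j Y \<le> L m n Y"
        unfolding L_eq_sum_sym_entry using nonneg j by (intro sum_mono2) auto
      moreover have "0 \<le> L m j Y"
        unfolding L_eq_sum_sym_entry using nonneg j by (intro sum_nonneg) auto
      moreover have "?e m j \<le> L m n Y" if "j \<in> {1..n}"
        unfolding L_eq_sum_sym_entry using nonneg that by (intro member_le_sum) auto
      ultimately show ?thesis
        using total[OF m] by auto
    qed
    have "0 \<le> L i j Y \<and> L i j Y \<le> 1" if i: "i \<in> {1..n}" and j: "j \<le> n" for i j
    proof -
      consider "i = 1" | "i = n" | "j = 0" | "j = 1" | "j = n - 1" | "j = n"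
        | "(i, j) \<in> {2..n-1} \<times> {2..n-2}"
        using i j by fastforce
      then show ?thesis
      proof cases
        case 1
        then show ?thesis
          using row[OF nonneg1 _ j] n by simp
      next
        case 2
        then show ?thesis
          using row[OF nonnegn _ j] n by simp
      next
        case 4
        then show ?thesis
          using row[OF nonneg1, of i] nonneg1[OF i] i first n by simp
      next
        case 5
        then show ?thesis
          using row[OF nonnegn, of i] nonnegn[OF i] i last[OF i] n by simp
      next
        case 6
        then show ?thesis
          using total[OF i] by simp
      next
        case 7
        then show ?thesis
          using lower[of i j] upper[of i j] by blast
      qed simp
    qed
    then show "Y \<in> partial_sum_polytope"
      using Y n by (simp add: partial_sum_polytope_def)
  qed
qed

text \<open>Turns an integer witness into a core. The boundary values of \<open>h\<close> make every
  row sum equal to 1.\<close>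

lemma row_sum_space_of_int_height:
  assumes sym: "\<And>i j. h i j = h j i"
    and bd: "\<And>j. j \<in> {0..int CARD('n::finite)} \<Longrightarrow> h 0 j = 0 \<and> h (int CARD('n)) j = j"
  obtains Y :: "real ^ ('n::finite) core_pos" where "Y \<in> row_sum_space"
    "\<And>i j. i \<in> {1..CARD('n)} \<Longrightarrow> j \<le> CARD('n) \<Longrightarrow>
      L i j Y = of_int (h (int i) (int j) - h (int i - 1) (int j))"
proof -
  define Y :: "real ^ 'n core_pos" where "Y = of_height (\<lambda>i j. of_int (h (int i) (int j)))"
  have L: "L i j Y = of_int (h (int i) (int j) - h (int i - 1) (int j))"
    if "i \<in> {1..CARD('n)}" "j \<le> CARD('n)" for i j
  proof -
    have "L i j Y = of_int (h (int i) (int j)) - of_int (h (int (i - 1)) (int j))"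
      unfolding Y_def
    proof (rule L_of_height[OF _ _ that])
      show "real_of_int (h (int i) (int j)) = real_of_int (h (int j) (int i))" for i j
        by (subst sym) (rule refl)
      show "real_of_int (h (int 0) (int j)) = 0" if "j \<le> CARD('n)" for j
        using bd[of "int j"] that by simp
    qed
    then show ?thesis
      using that by simp
  qed
  moreover have "Y \<in> row_sum_space"
    unfolding row_sum_space_def mem_Collect_eq
  proof
    fix i assume i: "i \<in> {1..CARD('n)}"
    then show "L i CARD('n) Y = 1"
      unfolding L[OF i order_refl] sym[of _ "int CARD('n)"] using bd[of "int i"] bd[of "int i - 1"] by simp
  qed
  ultimately show thesis
    using that by blast
qed

theorem theorem7p5:
  fixes n :: nat and P :: "(real ^ ('n::finite) core_pos) set"
  assumes "n = CARD('n)" and "n \<ge> 3" and "P = P_core_DSASM"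
  shows
    "bij_betw (\<lambda>((i, j), c). {Y \<in> P. L i j Y = c})
       ((({2..n-1} \<times> {2..n-2}) \<union> ({1..n} \<times> {1})) \<times> {0} \<union>
        (({2..n-1} \<times> {2..n-2}) \<union> ({2..n} \<times> {n-1})) \<times> {1})
       {F. F facet_of P}
     \<and> card {F. F facet_of P} = 2 * (n - 2)\<^sup>2 + 3"
proof -
  define A where "A = {2..n-1} \<times> {2..n-2} \<union> {1..n} \<times> {1}"
  define B where "B = {2..n-1} \<times> {2..n-2} \<union> {2..n} \<times> {n-1}"
  define K :: "((nat \<times> nat) \<times> real) set" where "K = A \<times> {0} \<union> B \<times> {1}"
  \<comment> \<open>The sign brings both families to the form \<open>f k Y\<close> at most
    \<open>snd k\<close>: \<open>- L i j Y\<close> at most 0, or \<open>L i j Y\<close> at most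
    1.\<close>
  define f :: "(nat \<times> nat) \<times> real \<Rightarrow> real ^ 'n core_pos \<Rightarrow> real" where
    "f = (\<lambda>((i, j), c) Y. if c = 0 then - L i j Y else L i j Y)"
  have AB: "(i, j) \<in> A \<longleftrightarrow> (int i, int j) \<in> lower_pos (int n)"
    "(i, j) \<in> B \<longleftrightarrow> (int i, int j) \<in> upper_pos (int n)" for i j
    using assms(2) unfolding A_def B_def lower_pos_def upper_pos_def by auto
  have range: "i \<in> {1..n}" "j \<in> {1..n-1}" if "(i, j) \<in> A \<union> B" for i j
    using that assms(2) by (auto simp: A_def B_def)
  have bij: "bij_betw (\<lambda>k. {Y \<in> P. f k Y = snd k}) K {F. F facet_of P}"
  proof (rule facets_of_irredundant_system)
    show "finite K"
      by (simp add: K_def A_def B_def)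
    show "linear (f k)" if "k \<in> K" for k
    proof -
      obtain i j c where fields: "k = ((i, j), c)"
        by (metis surj_pair)
      show ?thesis
        using linear_L[of i j] linear_compose_neg[OF linear_L[of i j]]
        by (cases "c = 0") (simp_all add: f_def fields)
    qed
    show "affine (row_sum_space :: (real ^ 'n core_pos) set)"
      by (rule affine_row_sum_space)
    have "P = {Y \<in> row_sum_space. (\<forall>(i, j)\<in>A. 0 \<le> L i j Y) \<and> (\<forall>(i, j)\<in>B. L i j Y \<le> 1)}"
      unfolding assms(3) P_core_DSASM_eq_partial_sum_polytope A_def B_def
      by (rule partial_sum_polytope_eq_reduced_system[OF assms(1,2) refl])
    moreover have "(\<forall>k\<in>K. f k Y \<le> snd k) \<longleftrightarrow> (\<forall>(i, j)\<in>A. 0 \<le> L i j Y) \<and> (\<forall>(i, j)\<in>B. L i j Y \<le> 1)" for Y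
      unfolding K_def ball_Un by (auto simp: f_def)
    ultimately show "P = {Y \<in> row_sum_space. \<forall>k\<in>K. f k Y \<le> snd k}"
      by simp
    \<comment> \<open>The core of the matrix with all entries \<open>1 / n\<close>, whose partial
      row sums \<open>j / n\<close> are strictly between 0 and 1 for \<open>j\<close> in
      \<open>{1..n-1}\<close>.\<close>
    define Z :: "real ^ 'n core_pos" where "Z = of_height (\<lambda>i j. real i * real j / real n)"
    have L_Z: "L i j Z = real j / real n" if "i \<in> {1..n}" "j \<le> n" for i j
    proof -
      have "L i j Z = real i * real j / real n - real (i - 1) * real j / real n"
        unfolding Z_def using that assms(1) by (intro L_of_height) auto
      then show ?thesis
        using that by (simp add: left_diff_distrib diff_divide_distrib)
    qed
    show "Z \<in> row_sum_space"
      using L_Z assms(1) by (simp add: row_sum_space_def)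
    show "f k Z < snd k" if k: "k \<in> K" for k
    proof -
      obtain i j c where fields: "k = ((i, j), c)"
        by (metis surj_pair)
      have "i \<in> {1..n}" "j \<in> {1..n-1}" "c = 0 \<or> c = 1"
        using k range[of i j] by (auto simp: K_def fields)
      then show ?thesis
        using L_Z[of i j] by (auto simp: f_def fields)
    qed
    show "\<exists>Y\<in>row_sum_space. f k Y > snd k \<and> (\<forall>k'\<in>K - {k}. f k' Y \<le> snd k')" if k: "k \<in> K" for k
    proof -
      obtain i0 j0 c where fields: "k = ((i0, j0), c)"
        by (metis surj_pair)
      have n: "int n \<ge> 3" "int n = int CARD('n)"
        using assms by auto
      obtain h where sym: "\<And>i j. h i j = h j i"
        and bd: "\<And>j. j \<in> {0..int n} \<Longrightarrow> h 0 j = 0 \<and> h (int n) j = j"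
        and viol: "if c = 0 then h (int i0) (int j0) - h (int i0 - 1) (int j0) < 0
          else h (int i0) (int j0) - h (int i0 - 1) (int j0) > 1"
        and lower: "\<And>i j. (i, j) \<in> lower_pos (int n) \<Longrightarrow> (c = 0 \<longrightarrow> (i, j) \<noteq> (int i0, int j0)) \<Longrightarrow>
          0 \<le> h i j - h (i - 1) j"
        and upper: "\<And>i j. (i, j) \<in> upper_pos (int n) \<Longrightarrow> (c \<noteq> 0 \<longrightarrow> (i, j) \<noteq> (int i0, int j0)) \<Longrightarrow>
          h i j - h (i - 1) j \<le> 1"
      proof (cases "c = 0")
        case True
        then have "(int i0, int j0) \<in> lower_pos (int n)"
          using k fields by (auto simp: K_def AB)
        from lower_witness[OF n(1) this] obtain h where h: "\<And>i j. h i j = h j i"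
          "\<And>j. j \<in> {0..int n} \<Longrightarrow> h 0 j = 0 \<and> h (int n) j = j"
          "h (int i0) (int j0) - h (int i0 - 1) (int j0) < 0"
          "\<And>i j. (i, j) \<in> lower_pos (int n) - {(int i0, int j0)} \<Longrightarrow> 0 \<le> h i j - h (i - 1) j"
          "\<And>i j. (i, j) \<in> upper_pos (int n) \<Longrightarrow> h i j - h (i - 1) j \<le> 1"
          by blast
        show thesis
          by (rule that[of h, OF h(1)]) (use True h(2-5) in simp_all)
      next
        case False
        then have "(int i0, int j0) \<in> upper_pos (int n)"
          using k fields by (auto simp: K_def AB)
        from upper_witness[OF n(1) this] obtain h where h: "\<And>i j. h i j = h j i"
          "\<And>j. j \<in> {0..int n} \<Longrightarrow> h 0 j = 0 \<and> h (int n) j = j"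
          "h (int i0) (int j0) - h (int i0 - 1) (int j0) > 1"
          "\<And>i j. (i, j) \<in> lower_pos (int n) \<Longrightarrow> 0 \<le> h i j - h (i - 1) j"
          "\<And>i j. (i, j) \<in> upper_pos (int n) - {(int i0, int j0)} \<Longrightarrow> h i j - h (i - 1) j \<le> 1"
          by blast
        show thesis
          by (rule that[of h, OF h(1)]) (use False h(2-5) in simp_all)
      qed
      obtain Y :: "real ^ 'n core_pos" where Y: "Y \<in> row_sum_space"
        and LY: "\<And>i j. i \<in> {1..n} \<Longrightarrow> j \<le> n \<Longrightarrow>
          L i j Y = of_int (h (int i) (int j) - h (int i - 1) (int j))"
        using row_sum_space_of_int_height[of h, where 'n = 'n] sym bd unfolding assms(1) by metis
      have LY': "L i j Y = of_int (h (int i) (int j) - h (int i - 1) (int j))" if "(i, j) \<in> A \<union> B" for i j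
        using range[OF that] by (intro LY) auto
      have k0: "(i0, j0) \<in> A \<union> B" "c = 0 \<or> c = 1"
        using k fields by (auto simp: K_def)
      have "f k Y > snd k"
        using viol k0(2) by (auto simp: fields f_def LY'[OF k0(1)] split: if_splits)
      moreover have "f k' Y \<le> snd k'" if k': "k' \<in> K - {k}" for k'
      proof -
        obtain i j c' where k'_eq: "k' = ((i, j), c')"
          by (metis surj_pair)
        consider "c' = 0" "(i, j) \<in> A" | "c' = 1" "(i, j) \<in> B"
          using k' by (auto simp: K_def k'_eq)
        then show ?thesis
        proof cases
          case 1
          then have "0 \<le> h (int i) (int j) - h (int i - 1) (int j)"
            using k' fields k'_eq by (intro lower) (auto simp: AB)
          then show ?thesis
            using 1 LY'[of i j] by (simp add: k'_eq f_def)
        next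
          case 2
          then have "h (int i) (int j) - h (int i - 1) (int j) \<le> 1"
            using k' fields k'_eq k0(2) by (intro upper) (auto simp: AB)
          then show ?thesis
            using 2 LY'[of i j] by (simp add: k'_eq f_def)
        qed
      qed
      ultimately show ?thesis
        using Y by blast
    qed
  qed
  have "bij_betw (\<lambda>((i, j), c). {Y \<in> P. L i j Y = c}) K {F. F facet_of P}"
    by (rule bij_betw_cong[THEN iffD1, OF _ bij]) (auto simp: K_def f_def)
  moreover have "card K = 2 * (n - 2)\<^sup>2 + 3"
  proof -
    \<comment> \<open>The shift removes truncated subtraction from the count.\<close>
    obtain m where m: "n = m + 3"
      using assms(2) by (metis add.commute le_Suc_ex)
    have "card A = (m + 1) * m + (m + 3)"
      unfolding A_def m by (subst card_Un_disjoint) (auto simp: card_cartesian_product)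
    moreover have "card B = (m + 1) * m + (m + 2)"
      unfolding B_def m by (subst card_Un_disjoint) (auto simp: card_cartesian_product)
    moreover have "card K = card A + card B"
      unfolding K_def by (subst card_Un_disjoint) (auto simp: card_cartesian_product A_def B_def)
    ultimately show ?thesis
      by (simp add: m power2_eq_square algebra_simps)
  qed
  ultimately show ?thesis
    using bij_betw_same_card[OF bij] unfolding K_def A_def B_def by simp
qed

end
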